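(* Let $f=(f_1,\dots,f_n):\{0,1\}^n\to\{0,1\}^n$ be a $k$-independent Boolean network whose interaction graph $G(f)$ has no loops. Then $IC(f_i)\geq k$ for every $i\in[n]$.
   Context: The interaction graph $G(f)$ is the digraph on $[n]$ with an arc $(i,j)$ iff there is $x\in\{0,1\}^n$ such that changing $x_i$ from $0$ to $1$ changes the value of $f_j(x)$; a loop is an arc $(i,i)$. $\mathrm{FP}(f)=\{x:f(x)=x\}$. For $I=\{i_1,\dots,i_k\}\subseteq[n]$, $x_I=(x_{i_1},\dots,x_{i_k})$. $f$ is $k$-independent if for every $k$-subset $I\subseteq[n]$ and every $a\in\{0,1\}^k$ there is $x\in\mathrm{FP}(f)$ with $x_I=a$. A function $h:\{0,1\}^n\to\{0,1\}$ is $k$-set canalizing if there exist $I\subseteq[n]$ with $|I|=k$ and values $a\in\{0,1\}^k$, $b\in\{0,1\}$ such that for all $x\in\{0,1\}^n$, $x_I=a$ implies $h(x)=b$. $IC(h)$ denotes the minimum $k$ such that $h$ is $k$-set canalizing.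
   Formalization: The assumption k ≤ n is made explicit: for k > n there are no k-subsets of [n], so every network is vacuously k-independent while IC(f_i) ≤ n < k, and the claim would fail. *)

theory Defs
  imports "HOL-Library.FuncSet" "HOL-Library.Cardinality"
begin

text \<open>The index set \<open>[n]\<close> is a finite type \<open>'n\<close>, so \<open>n = CARD('n)\<close>, and
  \<open>{0,1}\<^sup>n\<close> is \<open>'n \<Rightarrow> bool\<close>.  The subtuple \<open>x\<^sub>I\<close> is \<open>restrict x I\<close>, and a value tuple
  \<open>a \<in> {0,1}\<^sup>k\<close> for the coordinates in \<open>I\<close> is an element of \<open>I \<rightarrow>\<^sub>E UNIV\<close>.\<close>

type_synonym 'n config = "'n \<Rightarrow> bool"

definition interaction_graph :: "('n::finite config \<Rightarrow> 'n config) \<Rightarrow> ('n \<times> 'n) set" where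
  "interaction_graph f = {(i, j). \<exists>x. \<not> x i \<and> f (x(i := True)) j \<noteq> f x j}"

definition FP :: "('n::finite config \<Rightarrow> 'n config) \<Rightarrow> 'n config set" where
  "FP f = {x. f x = x}"

definition k_independent :: "nat \<Rightarrow> ('n::finite config \<Rightarrow> 'n config) \<Rightarrow> bool" where
  "k_independent k f \<longleftrightarrow>
     (\<forall>I. card I = k \<longrightarrow> (\<forall>a \<in> I \<rightarrow>\<^sub>E UNIV. \<exists>x \<in> FP f. restrict x I = a))"

definition set_canalizing :: "nat \<Rightarrow> ('n::finite config \<Rightarrow> bool) \<Rightarrow> bool" where
  "set_canalizing k h \<longleftrightarrow>
     (\<exists>I. card I = k \<and> (\<exists>a \<in> I \<rightarrow>\<^sub>E UNIV. \<exists>b. \<forall>x. restrict x I = a \<longrightarrow> h x = b))"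

definition IC :: "('n::finite config \<Rightarrow> bool) \<Rightarrow> nat" where
  "IC h = (LEAST k. set_canalizing k h)"

text \<open>The minimum defining \<open>IC\<close> is taken over a nonempty set.\<close>

lemma set_canalizing_card: "set_canalizing CARD('n) (h :: 'n::finite config \<Rightarrow> bool)"
  unfolding set_canalizing_def
  by (rule exI[of _ UNIV]) (auto simp: restrict_UNIV)

lemma set_canalizing_IC: "set_canalizing (IC h) h"
  unfolding IC_def by (rule LeastI) (rule set_canalizing_card)

end

theory Submission imports Defs begin

text \<open>Without a loop at \<open>i\<close>, the function \<open>f\<^sub>i\<close> ignores \<open>x\<^sub>i\<close>. Hence, when fewer than \<open>k\<close>
  coordinates are prescribed, one may first choose a fixed point with these coordinates (those
  other than \<open>x\<^sub>i\<close>) and with \<open>x\<^sub>i = b\<close>, where \<open>f\<^sub>i\<close> then takes the value \<open>b\<close>, and afterwards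
  overwrite \<open>x\<^sub>i\<close> by its prescribed value. So no such prescription forces the value of \<open>f\<^sub>i\<close>.\<close>

lemma restrict_eq_restrict_iff: "restrict x I = restrict y I \<longleftrightarrow> (\<forall>j\<in>I. x j = y j)"
  by (auto simp: restrict_def fun_eq_iff)

lemma PiE_UNIV_eq_range_restrict: "I \<rightarrow>\<^sub>E UNIV = range (\<lambda>x. restrict x I)"
  by (auto simp: image_iff intro: PiE_restrict[symmetric])

lemma k_independent_iff:
  "k_independent k f \<longleftrightarrow> (\<forall>I a. card I = k \<longrightarrow> (\<exists>x\<in>FP f. \<forall>j\<in>I. x j = a j))"
  unfolding k_independent_def PiE_UNIV_eq_range_restrict
  by (simp add: restrict_eq_restrict_iff)

lemma set_canalizing_iff:
  "set_canalizing k h \<longleftrightarrow> (\<exists>I a b. card I = k \<and> (\<forall>x. (\<forall>j\<in>I. x j = a j) \<longrightarrow> h x = b))"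
  unfolding set_canalizing_def PiE_UNIV_eq_range_restrict
  by (simp add: restrict_eq_restrict_iff)

lemma le_IC_iff: "k \<le> IC h \<longleftrightarrow> (\<forall>I a b. card I < k \<longrightarrow> (\<exists>x. (\<forall>j\<in>I. x j = a j) \<and> h x \<noteq> b))"
proof -
  have "IC h \<le> m" if "set_canalizing m h" for m
    using that unfolding IC_def by (rule Least_le)
  then have "k \<le> IC h \<longleftrightarrow> (\<forall>m<k. \<not> set_canalizing m h)"
    using set_canalizing_IC[of h] by (meson leD leI le_trans)
  then show ?thesis
    unfolding set_canalizing_iff by auto
qed

lemma k_independent_antimono:
  fixes f :: "'n::finite config \<Rightarrow> 'n config"
  assumes "k_independent k f" "m \<le> k" "k \<le> CARD('n)"
  shows "k_independent m f"
  unfolding k_independent_iff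
proof (intro allI impI)
  fix I :: "'n set" and a
  assume "card I = m"
  then obtain K where "I \<subseteq> K" "card K = k"
    using exists_subset_between[of I k UNIV] assms(2,3) by auto
  moreover obtain x where "x \<in> FP f" "\<forall>j\<in>K. x j = a j"
    using assms(1) \<open>card K = k\<close> unfolding k_independent_iff by blast
  ultimately show "\<exists>x\<in>FP f. \<forall>j\<in>I. x j = a j"
    by blast
qed

lemma fun_upd_eq_if_no_arc:
  assumes "(i, j) \<notin> interaction_graph f"
  shows "f (x(i := v)) j = f x j"
proof -
  have flip: "f (y(i := True)) j = f y j" if "\<not> y i" for y
    using assms that by (auto simp: interaction_graph_def)
  have upd_True: "f (x(i := u)) j = f (x(i := True)) j" for u
    using flip[of "x(i := False)"] by (cases u) simp_all
  show ?thesis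
    using upd_True[of v] upd_True[of "x i"] by simp
qed

lemma k_independent_attains_value:
  fixes f :: "'n::finite config \<Rightarrow> 'n config"
  assumes "k_independent k f" "k \<le> CARD('n)" "(i, i) \<notin> interaction_graph f" "card I < k"
  shows "\<exists>x. (\<forall>j\<in>I. x j = a j) \<and> f x i = b"
proof -
  have "card (insert i I) \<le> k"
    using assms(4) by (simp add: card_insert_if)
  then have "k_independent (card (insert i I)) f"
    using k_independent_antimono assms(1,2) by blast
  then obtain y where "f y = y" and y: "\<forall>j\<in>insert i I. y j = (a(i := b)) j"
    unfolding k_independent_iff FP_def by blast
  have "f (y(i := a i)) i = f y i"
    using assms(3) by (rule fun_upd_eq_if_no_arc)
  also have "\<dots> = b"
    using \<open>f y = y\<close> y by simp
  finally have "f (y(i := a i)) i = b" .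
  moreover have "\<forall>j\<in>I. (y(i := a i)) j = a j"
    using y by simp
  ultimately show ?thesis
    by blast
qed

theorem theorem2p5:
  fixes f :: "'n::finite config \<Rightarrow> 'n config" and k :: nat
  assumes "k \<le> CARD('n)"
    and "k_independent k f"
    and "\<forall>i. (i, i) \<notin> interaction_graph f"
  shows "\<forall>i. IC (\<lambda>x. f x i) \<ge> k"
proof
  fix i
  have "\<exists>x. (\<forall>j\<in>I. x j = a j) \<and> f x i \<noteq> b" if "card I < k" for I a b
    using k_independent_attains_value[of k f i I a "\<not> b"] assms that by auto
  then show "IC (\<lambda>x. f x i) \<ge> k"
    unfolding le_IC_iff by blast
qed

end
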